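(* With the notation below, $\hat G=\hat K_{x_0}\hat B$, i.e. every $g\in\hat G$ can be written $g=kb$ with $k\in\hat K_{x_0}$ and $b\in\hat B$.
   Context: Let $F$ be a non-archimedean local field with ring of integers $\mathfrak{o}$, uniformizer $\varpi$, and finite residue field of cardinality $q$. $X=X_{PGL_2(F)}$ is the Bruhat–Tits tree of $PGL_2(F)$: vertices are homothety classes of $\mathfrak{o}$-lattices in $F^2$, with $[L],[L']$ adjacent iff there are representatives with $\varpi L\subsetneq L'\subsetneq L$; it is $(q+1)$-regular. $d$ is the path-length distance; $\mathrm{Aut}(X)$ is the group of distance-preserving bijections of the vertex set with the topology of pointwise convergence, and $PGL_2(F)\hookrightarrow\mathrm{Aut}(X)$ via the linear action on lattices. For an edge $\eta=\{y_1,y_2\}$ and $e\ge1$, $B(\eta,e)=\{y:\min(d(y,y_1),d(y,y_2))\le e\}$, and $\hat G=\hat G^{(e)}=\{g\in\mathrm{Aut}(X):\forall\eta\ \exists g'\in PGL_2(F),\ g|_{B(\eta,e)}=g'|_{B(\eta,e)}\}$ for a fixed $e\ge1$. Ends are equivalence classes of infinite paths (agreeing after an index shift from some point on). Fix a doubly infinite path $(x_n)_{n\in\mathbb{Z}}$; let $\omega$ be the end of $(x_n)_{n\ge0}$ and $\omega'$ the end of $(x_{-n})_{n\ge0}$. Set $\hat B=\{g\in\hat G: g(\omega)=\omega\}$, $\hat K_{x_0}=\{g\in\hat G: g(x_0)=x_0\}$. *)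

theory Defs
  imports Main
begin

text \<open>v is a normalized discrete valuation on the nonzero elements (its value at 0 is irrelevant).\<close>

definition val_ring :: "('a::field \<Rightarrow> int) \<Rightarrow> 'a set" where
  "val_ring v = {x. x = 0 \<or> v x \<ge> 0}"

definition val_ideal :: "('a::field \<Rightarrow> int) \<Rightarrow> 'a set" where
  "val_ideal v = {x. x = 0 \<or> v x \<ge> 1}"

definition nonarch_local_field :: "('a::field \<Rightarrow> int) \<Rightarrow> bool" where
  "nonarch_local_field v \<longleftrightarrow>
     (\<forall>x y. x \<noteq> 0 \<longrightarrow> y \<noteq> 0 \<longrightarrow> v (x * y) = v x + v y) \<and>
     (\<forall>x y. x \<noteq> 0 \<longrightarrow> y \<noteq> 0 \<longrightarrow> x + y \<noteq> 0 \<longrightarrow> v (x + y) \<ge> min (v x) (v y)) \<and>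
     (\<exists>p. p \<noteq> 0 \<and> v p = 1) \<and>
     finite ((\<lambda>x. {y \<in> val_ring v. x - y \<in> val_ideal v}) ` val_ring v) \<and>
     (\<forall>s :: nat \<Rightarrow> 'a.
        (\<forall>N::int. \<exists>M. \<forall>m\<ge>M. \<forall>n\<ge>M. s m = s n \<or> v (s m - s n) \<ge> N) \<longrightarrow>
        (\<exists>L. \<forall>N::int. \<exists>M. \<forall>n\<ge>M. s n = L \<or> v (s n - L) \<ge> N))"

definition scale :: "'a::field \<Rightarrow> ('a \<times> 'a) set \<Rightarrow> ('a \<times> 'a) set" where
  "scale c L = (\<lambda>(x, y). (c * x, c * y)) ` L"

definition lattice :: "('a::field \<Rightarrow> int) \<Rightarrow> ('a \<times> 'a) set \<Rightarrow> bool" where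
  "lattice v L \<longleftrightarrow> (\<exists>a1 a2 b1 b2. a1 * b2 - a2 * b1 \<noteq> 0 \<and>
      L = {(s * a1 + t * b1, s * a2 + t * b2) | s t. s \<in> val_ring v \<and> t \<in> val_ring v})"

definition hclass :: "('a::field \<times> 'a) set \<Rightarrow> ('a \<times> 'a) set set" where
  "hclass L = {scale c L | c. c \<noteq> 0}"

definition vertices :: "('a::field \<Rightarrow> int) \<Rightarrow> ('a \<times> 'a) set set set" where
  "vertices v = {hclass L | L. lattice v L}"

definition adj :: "('a::field \<Rightarrow> int) \<Rightarrow> 'a \<Rightarrow> ('a \<times> 'a) set set \<Rightarrow> ('a \<times> 'a) set set \<Rightarrow> bool" where
  "adj v w X Y \<longleftrightarrow> X \<in> vertices v \<and> Y \<in> vertices v \<and>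
     (\<exists>L\<in>X. \<exists>L'\<in>Y. scale w L \<subset> L' \<and> L' \<subset> L)"

definition tdist :: "('a::field \<Rightarrow> int) \<Rightarrow> 'a \<Rightarrow> ('a \<times> 'a) set set \<Rightarrow> ('a \<times> 'a) set set \<Rightarrow> nat" where
  "tdist v w X Y = (LEAST n. \<exists>p :: nat \<Rightarrow> ('a \<times> 'a) set set.
       p 0 = X \<and> p n = Y \<and> (\<forall>i<n. adj v w (p i) (p (Suc i))))"

definition tree_aut :: "('a::field \<Rightarrow> int) \<Rightarrow> 'a \<Rightarrow> (('a \<times> 'a) set set \<Rightarrow> ('a \<times> 'a) set set) \<Rightarrow> bool" where
  "tree_aut v w g \<longleftrightarrow> bij_betw g (vertices v) (vertices v) \<and>
     (\<forall>x\<in>vertices v. \<forall>y\<in>vertices v. tdist v w (g x) (g y) = tdist v w x y)"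

definition mat_act :: "'a::field \<times> 'a \<times> 'a \<times> 'a \<Rightarrow> 'a \<times> 'a \<Rightarrow> 'a \<times> 'a" where
  "mat_act M p = (case M of (a, b, c, d) \<Rightarrow> (a * fst p + b * snd p, c * fst p + d * snd p))"

definition invertible2 :: "'a::field \<times> 'a \<times> 'a \<times> 'a \<Rightarrow> bool" where
  "invertible2 M = (case M of (a, b, c, d) \<Rightarrow> a * d - b * c \<noteq> 0)"

definition vact :: "'a::field \<times> 'a \<times> 'a \<times> 'a \<Rightarrow> ('a \<times> 'a) set set \<Rightarrow> ('a \<times> 'a) set set" where
  "vact M X = (\<lambda>L. mat_act M ` L) ` X"

definition edge_ball :: "('a::field \<Rightarrow> int) \<Rightarrow> 'a \<Rightarrow> ('a \<times> 'a) set set \<Rightarrow> ('a \<times> 'a) set set \<Rightarrow> nat \<Rightarrow> ('a \<times> 'a) set set set" where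
  "edge_ball v w y1 y2 e = {y \<in> vertices v. min (tdist v w y y1) (tdist v w y y2) \<le> e}"

definition Ghat :: "('a::field \<Rightarrow> int) \<Rightarrow> 'a \<Rightarrow> nat \<Rightarrow> (('a \<times> 'a) set set \<Rightarrow> ('a \<times> 'a) set set) set" where
  "Ghat v w e = {g. tree_aut v w g \<and>
     (\<forall>y1 y2. adj v w y1 y2 \<longrightarrow>
        (\<exists>M. invertible2 M \<and> (\<forall>y\<in>edge_ball v w y1 y2 e. g y = vact M y)))}"

definition ray :: "('a::field \<Rightarrow> int) \<Rightarrow> 'a \<Rightarrow> (nat \<Rightarrow> ('a \<times> 'a) set set) \<Rightarrow> bool" where
  "ray v w r \<longleftrightarrow> inj r \<and> (\<forall>n. adj v w (r n) (r (Suc n)))"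

definition biinf_path :: "('a::field \<Rightarrow> int) \<Rightarrow> 'a \<Rightarrow> (int \<Rightarrow> ('a \<times> 'a) set set) \<Rightarrow> bool" where
  "biinf_path v w xs \<longleftrightarrow> inj xs \<and> (\<forall>n. adj v w (xs n) (xs (n + 1)))"

definition same_end :: "(nat \<Rightarrow> 'b) \<Rightarrow> (nat \<Rightarrow> 'b) \<Rightarrow> bool" where
  "same_end r s \<longleftrightarrow> (\<exists>i j. \<forall>n. r (n + i) = s (n + j))"

end

theory Submission
  imports Defs
begin

text \<open>
  In suitable coordinates every ray is the standard ray $[\mathfrak o e_1 + \varpi^n \mathfrak o e_2]$:
  a ray from the class of $\mathfrak o^2$ is cut out step by step by lower unipotent matrices whose
  off-diagonal entries form a Cauchy sequence, and completeness of $F$ gives the coordinates in the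
  limit. Hence $x_n = A D_n x$ and $g(x_n) = A' D_n x$ for $n \ge 0$, where
  $D_n = \mathrm{diag}(1,\varpi^n)$ and $x$ is the class of $\mathfrak o^2$. The Iwasawa decomposition
  $A^{-1}A' = KT$ yields $k = AKA^{-1} \in PGL_2(F)$, which fixes $x_0$ and sends $\omega$ to
  $g(\omega)$ because the upper triangular $T$ only shifts the tail of the standard ray; put
  $b = k^{-1}g$.
\<close>

section \<open>Two-by-two matrices and their action on sets of lattices\<close>

type_synonym 'a mat2 = "'a \<times> 'a \<times> 'a \<times> 'a"

fun mmul :: "'a::field mat2 \<Rightarrow> 'a mat2 \<Rightarrow> 'a mat2" where
  "mmul (a, b, c, d) (a', b', c', d') =
     (a * a' + b * c', a * b' + b * d', c * a' + d * c', c * b' + d * d')"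

fun minv :: "'a::field mat2 \<Rightarrow> 'a mat2" where
  "minv (a, b, c, d) =
     (d / (a * d - b * c), - b / (a * d - b * c), - c / (a * d - b * c), a / (a * d - b * c))"

lemma mmul_assoc: "mmul (mmul A B) C = mmul A (mmul B C)"
  by (cases A; cases B; cases C) (simp add: algebra_simps)

lemma mmul_one_left [simp]: "mmul (1, 0, 0, 1) A = A"
  by (cases A) simp

lemma minv_left: "invertible2 M \<Longrightarrow> mmul (minv M) M = (1, 0, 0, 1)"
  by (cases M) (simp add: invertible2_def mult.commute flip: diff_divide_distrib)

lemma minv_right: "invertible2 M \<Longrightarrow> mmul M (minv M) = (1, 0, 0, 1)"
  by (cases M) (simp add: invertible2_def mult.commute flip: diff_divide_distrib)

text \<open>Multiplicativity of the determinant, spelled out in entries so that it can serve as a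
  rewrite rule in either direction.\<close>

lemma det_mmul:
  fixes a b c d a' b' c' d' :: "'a::field"
  shows "(a * a' + b * c') * (c * b' + d * d') - (a * b' + b * d') * (c * a' + d * c')
    = (a * d - b * c) * (a' * d' - b' * c')"
  by (simp add: algebra_simps)

lemma invertible2_mmul:
  "invertible2 A \<Longrightarrow> invertible2 B \<Longrightarrow> invertible2 (mmul A B)"
  \<comment> \<open>\<open>right_minus_eq\<close> would turn \<open>a * d - b * c \<noteq> 0\<close>
    into a disequality of products, which \<open>det_mmul\<close> no longer matches.\<close>
  by (cases A; cases B) (simp add: invertible2_def det_mmul del: right_minus_eq)

lemma invertible2_minv:
  assumes "invertible2 M" shows "invertible2 (minv M)"
proof -
  obtain a b c d where M: "M = (a, b, c, d)" by (cases M)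
  obtain a' b' c' d' where N: "minv M = (a', b', c', d')" by (cases "minv M")
  have "mmul (a', b', c', d') (a, b, c, d) = (1, 0, 0, 1)"
    using minv_left [OF assms] unfolding N unfolding M .
  then have "(a' * d' - b' * c') * (a * d - b * c) = 1"
    by (simp flip: det_mmul)
  then show ?thesis by (auto simp: N invertible2_def)
qed

lemma mat_act_mmul: "mat_act (mmul A B) p = mat_act A (mat_act B p)"
  by (cases A; cases B; cases p) (simp add: mat_act_def algebra_simps)

lemma mat_act_one: "mat_act (1, 0, 0, 1) p = p"
  by (simp add: mat_act_def)

lemma mat_act_minv_left: "invertible2 M \<Longrightarrow> mat_act (minv M) (mat_act M p) = p"
  by (simp flip: mat_act_mmul add: minv_left mat_act_one)

lemma mat_act_minv_right: "invertible2 M \<Longrightarrow> mat_act M (mat_act (minv M) p) = p"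
  by (simp flip: mat_act_mmul add: minv_right mat_act_one)

lemma inj_mat_act: "invertible2 M \<Longrightarrow> inj (mat_act M)"
  by (metis injI mat_act_minv_left)

lemma mat_act_image_psubset_iff:
  assumes "invertible2 M" shows "mat_act M ` P \<subset> mat_act M ` Q \<longleftrightarrow> P \<subset> Q"
  using inj_image_subset_iff [OF inj_mat_act [OF assms]] by (simp add: less_le_not_le)

lemma vact_mmul: "vact (mmul A B) X = vact A (vact B X)"
  by (simp add: vact_def image_image mat_act_mmul)

lemma vact_one [simp]: "vact (1, 0, 0, 1) X = X"
  by (simp add: vact_def mat_act_one)

lemma vact_minv_left: "invertible2 M \<Longrightarrow> vact (minv M) (vact M X) = X"
  by (simp flip: vact_mmul add: minv_left)

lemma vact_minv_right: "invertible2 M \<Longrightarrow> vact M (vact (minv M) X) = X"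
  by (simp flip: vact_mmul add: minv_right)

section \<open>Homothety classes and the vertices of the tree\<close>

lemma scale_eq_mat_act: "scale c L = mat_act (c, 0, 0, c) ` L"
  by (simp add: scale_def mat_act_def case_prod_unfold)

lemma scale_scale: "scale c (scale d L) = scale (c * d) L"
  by (simp add: scale_eq_mat_act image_image flip: mat_act_mmul)

lemma scale_one [simp]: "scale 1 L = L"
  by (simp add: scale_eq_mat_act mat_act_one)

text \<open>Scalar matrices are central. Hence \<open>M\<close> respects homothety classes and the
  inclusions that define adjacency.\<close>

lemma mat_act_scale: "mat_act M ` scale c L = scale c (mat_act M ` L)"
  by (cases M) (simp add: scale_eq_mat_act image_image flip: mat_act_mmul add: mult.commute)

lemma vact_hclass: "vact M (hclass L) = hclass (mat_act M ` L)"
  by (auto simp: vact_def hclass_def mat_act_scale image_iff) (metis mat_act_scale)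

lemma hclass_scale:
  assumes "c \<noteq> 0" shows "hclass (scale c L) = hclass L"
proof -
  have "scale d L = scale (d / c * c) L" for d using assms by simp
  moreover have "d / c \<noteq> 0" "d * c \<noteq> 0" if "d \<noteq> 0" for d using that assms by auto
  ultimately show ?thesis unfolding hclass_def scale_scale by blast
qed

lemma hclass_scalar_mat: "c \<noteq> 0 \<Longrightarrow> vact (c, 0, 0, c) (hclass L) = hclass L"
  by (simp add: vact_hclass hclass_scale flip: scale_eq_mat_act)

text \<open>The basis vectors of a lattice become the columns of \<open>M\<close>. Every vertex is
  thus a translate of one base vertex, and questions about vertices turn into matrix
  identities.\<close>

lemma lattice_iff: "lattice v L \<longleftrightarrow> (\<exists>M. invertible2 M \<and> L = mat_act M ` (val_ring v \<times> val_ring v))"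
proof -
  have "mat_act (a1, b1, a2, b2) ` (val_ring v \<times> val_ring v) =
      {(s * a1 + t * b1, s * a2 + t * b2) | s t. s \<in> val_ring v \<and> t \<in> val_ring v}" for a1 a2 b1 b2
    by (force simp: mat_act_def mult.commute)
  moreover have "a1 * b2 - a2 * b1 \<noteq> 0 \<longleftrightarrow> invertible2 (a1, b1, a2, b2)" for a1 a2 b1 b2 :: 'a
    by (simp add: invertible2_def mult.commute)
  ultimately show ?thesis
    unfolding lattice_def by auto
qed

definition base_vertex :: "('a::field \<Rightarrow> int) \<Rightarrow> ('a \<times> 'a) set set" where
  "base_vertex v = hclass (val_ring v \<times> val_ring v)"

lemma vertices_eq: "vertices v = {vact M (base_vertex v) | M. invertible2 M}"
  unfolding vertices_def lattice_iff base_vertex_def vact_hclass by blast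

lemma vact_vertices: "invertible2 M \<Longrightarrow> X \<in> vertices v \<Longrightarrow> vact M X \<in> vertices v"
  unfolding vertices_eq using vact_mmul [symmetric] invertible2_mmul by blast

section \<open>Matrices as automorphisms of the tree, and the group \<open>Ghat\<close>\<close>

lemma vact_adj:
  assumes M: "invertible2 M" and "adj v w X Y"
  shows "adj v w (vact M X) (vact M Y)"
proof -
  obtain L L' where "L \<in> X" "L' \<in> Y" "scale w L \<subset> L'" "L' \<subset> L"
    using assms(2) unfolding adj_def by blast
  then have L_act: "mat_act M ` L \<in> vact M X" "mat_act M ` L' \<in> vact M Y"
    "scale w (mat_act M ` L) \<subset> mat_act M ` L'" "mat_act M ` L' \<subset> mat_act M ` L"
    by (simp_all add: vact_def mat_act_image_psubset_iff [OF M] flip: mat_act_scale)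
  have "vact M X \<in> vertices v" "vact M Y \<in> vertices v"
    using assms by (simp_all add: adj_def vact_vertices)
  then show ?thesis
    unfolding adj_def using L_act(3,4) by (intro conjI bexI [OF _ L_act(1)] bexI [OF _ L_act(2)])
qed

lemma tdist_vact:
  assumes M: "invertible2 M"
  shows "tdist v w (vact M X) (vact M Y) = tdist v w X Y"
proof -
  define joined where "joined n X Y \<longleftrightarrow>
      (\<exists>p. p 0 = X \<and> p n = Y \<and> (\<forall>i<n. adj v w (p i) (p (Suc i))))" for n X Y
  have path: "joined n (vact N X) (vact N Y)" if N: "invertible2 N" and "joined n X Y" for N n X Y
  proof -
    obtain p where "p 0 = X" "p n = Y" "\<forall>i<n. adj v w (p i) (p (Suc i))"
      using \<open>joined n X Y\<close> unfolding joined_def by blast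
    then show ?thesis
      unfolding joined_def by (intro exI [of _ "\<lambda>i. vact N (p i)"]) (simp add: vact_adj [OF N])
  qed
  \<comment> \<open>\<open>M\<close> and its inverse carry paths to paths of the same length, so
    both \<open>LEAST\<close> operators range over the same set of lengths, even if that set is
    empty.\<close>
  have "joined n (vact M X) (vact M Y) \<longleftrightarrow> joined n X Y" for n
    using path [OF M, of n X Y] path [OF invertible2_minv [OF M], of n "vact M X" "vact M Y"]
    by (auto simp: vact_minv_left [OF M])
  then show ?thesis unfolding tdist_def joined_def by simp
qed

lemma tdist_self [simp]: "tdist v w X X = 0"
  unfolding tdist_def by (rule Least_eq_0) auto

lemma tree_aut_vact:
  assumes M: "invertible2 M" shows "tree_aut v w (vact M)"
proof -
  have "bij_betw (vact M) (vertices v) (vertices v)"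
    by (rule bij_betw_byWitness [where f' = "vact (minv M)"])
      (auto simp: vact_minv_left [OF M] vact_minv_right [OF M] vact_vertices M invertible2_minv)
  then show ?thesis by (simp add: tree_aut_def tdist_vact [OF M])
qed

text \<open>One matrix witnesses the local condition at all edges, for every radius.\<close>

lemma vact_in_Ghat: "invertible2 M \<Longrightarrow> vact M \<in> Ghat v w e"
  unfolding Ghat_def using tree_aut_vact by blast

text \<open>Where \<open>g\<close> agrees with \<open>N\<close> on an edge ball, the composite
  agrees with \<open>mmul M N\<close> there. This will put \<open>b\<close>, the inverse of
  \<open>k\<close> followed after \<open>g\<close>, into \<open>Ghat\<close>.\<close>

lemma vact_comp_in_Ghat:
  assumes M: "invertible2 M" and g: "g \<in> Ghat v w e"
  shows "vact M \<circ> g \<in> Ghat v w e"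
proof -
  have "tree_aut v w (vact M \<circ> g)"
    using tree_aut_vact [OF M] g unfolding Ghat_def tree_aut_def
    by (auto intro: bij_betw_trans simp: bij_betwE tdist_vact [OF M])
  moreover have "\<exists>N. invertible2 N \<and> (\<forall>y\<in>edge_ball v w y1 y2 e. (vact M \<circ> g) y = vact N y)"
    if "adj v w y1 y2" for y1 y2
  proof -
    obtain N where "invertible2 N" "\<forall>y\<in>edge_ball v w y1 y2 e. g y = vact N y"
      using g \<open>adj v w y1 y2\<close> unfolding Ghat_def by blast
    then show ?thesis
      by (intro exI [of _ "mmul M N"]) (simp add: vact_mmul invertible2_mmul M)
  qed
  ultimately show ?thesis by (simp add: Ghat_def)
qed

text \<open>
  Distance preservation does not give this at once, because \<open>tdist\<close> is a junk value for pairs of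
  vertices that no path joins.
\<close>
lemma Ghat_adj:
  assumes "g \<in> Ghat v w e" and a: "adj v w X Y"
  shows "adj v w (g X) (g Y)"
proof -
  obtain M where "invertible2 M" "\<forall>y\<in>edge_ball v w X Y e. g y = vact M y"
    using assms unfolding Ghat_def by blast
  moreover have "X \<in> edge_ball v w X Y e" "Y \<in> edge_ball v w X Y e"
    using a by (auto simp: edge_ball_def adj_def)
  ultimately show ?thesis using vact_adj [OF _ a] by metis
qed

section \<open>The valuation and its ring of integers\<close>

locale valued_field =
  fixes v :: "'a::field \<Rightarrow> int" and w :: 'a
  assumes local_field: "nonarch_local_field v"
    and w_nonzero [simp]: "w \<noteq> 0" and v_w [simp]: "v w = 1"
begin

abbreviation ring_of_integers ("\<O>") where "\<O> \<equiv> val_ring v"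

lemma v_mult: "x \<noteq> 0 \<Longrightarrow> y \<noteq> 0 \<Longrightarrow> v (x * y) = v x + v y"
  using local_field unfolding nonarch_local_field_def by blast

lemma v_add: "x \<noteq> 0 \<Longrightarrow> y \<noteq> 0 \<Longrightarrow> x + y \<noteq> 0 \<Longrightarrow> min (v x) (v y) \<le> v (x + y)"
  using local_field unfolding nonarch_local_field_def by blast

lemma v_one [simp]: "v 1 = 0"
  using v_mult [of 1 1] by simp

lemma v_minus: "x \<noteq> 0 \<Longrightarrow> v (- x) = v x"
  \<comment> \<open>Twice \<open>v (-1)\<close> equals \<open>v 1\<close>, so \<open>v (-1)\<close>
    is 0.\<close>
  using v_mult [of "-1" "-1"] v_mult [of "-1" x] by simp

lemma v_inverse: "x \<noteq> 0 \<Longrightarrow> v (inverse x) = - v x"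
  using v_mult [of x "inverse x"] by simp

lemma v_divide: "x \<noteq> 0 \<Longrightarrow> y \<noteq> 0 \<Longrightarrow> v (x / y) = v x - v y"
  by (simp add: divide_inverse v_mult v_inverse)

lemma v_power: "v (w ^ n) = int n"
  by (induction n) (simp_all add: v_mult)

lemma v_powi: "v (w powi n) = n"
  by (simp add: power_int_def v_power v_inverse power_inverse)

lemma ring_0 [simp]: "0 \<in> \<O>" and ring_1 [simp]: "1 \<in> \<O>"
  by (simp_all add: val_ring_def)

lemma ring_mult: "x \<in> \<O> \<Longrightarrow> y \<in> \<O> \<Longrightarrow> x * y \<in> \<O>"
  by (cases "x = 0 \<or> y = 0") (auto simp: val_ring_def v_mult)

lemma ring_minus: "x \<in> \<O> \<Longrightarrow> - x \<in> \<O>"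
  by (cases "x = 0") (auto simp: val_ring_def v_minus)

lemma ring_add: "x \<in> \<O> \<Longrightarrow> y \<in> \<O> \<Longrightarrow> x + y \<in> \<O>"
  using v_add [of x y] by (cases "x = 0 \<or> y = 0 \<or> x + y = 0") (auto simp: val_ring_def)

lemma ring_diff: "x \<in> \<O> \<Longrightarrow> y \<in> \<O> \<Longrightarrow> x - y \<in> \<O>"
  using ring_add [of x "- y"] ring_minus [of y] by simp

text \<open>An integer not divisible by the uniformizer has valuation 0, hence is a unit.
  Divisibility is the form in which lattices between \<open>w\<close> times O^2 and O^2 are analysed
  below.\<close>

lemma ring_inverse: "x \<in> \<O> \<Longrightarrow> x / w \<notin> \<O> \<Longrightarrow> inverse x \<in> \<O>"
  by (cases "x = 0") (auto simp: val_ring_def v_inverse v_divide)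

lemma ring_unit_inverse: "v x = 0 \<Longrightarrow> inverse x \<in> \<O>"
  by (cases "x = 0") (auto simp: val_ring_def v_inverse)

section \<open>The group GL_2(O) and the vertex that it fixes\<close>

abbreviation base ("\<xi>") where "\<xi> \<equiv> base_vertex v"

text \<open>The determinant must be a unit. Its nonvanishing is a separate conjunct because
  \<open>v 0\<close> is unspecified.\<close>

definition GL2_O :: "'a mat2 set" where
  "GL2_O = {(a, b, c, d) | a b c d.
     a \<in> \<O> \<and> b \<in> \<O> \<and> c \<in> \<O> \<and> d \<in> \<O> \<and> a * d - b * c \<noteq> 0 \<and> v (a * d - b * c) = 0}"

lemma GL2_O_invertible: "K \<in> GL2_O \<Longrightarrow> invertible2 K"
  by (auto simp: GL2_O_def invertible2_def)

lemma GL2_O_image: "K \<in> GL2_O \<Longrightarrow> mat_act K ` (\<O> \<times> \<O>) \<subseteq> \<O> \<times> \<O>"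
  by (auto simp: GL2_O_def mat_act_def intro!: ring_add ring_mult)

lemma GL2_O_minv:
  assumes "K \<in> GL2_O" shows "minv K \<in> GL2_O"
proof -
  obtain a b c d where K: "K = (a, b, c, d)" by (cases K)
  define D where "D = a * d - b * c"
  have D: "D \<noteq> 0" "v D = 0" and abcd: "a \<in> \<O>" "b \<in> \<O>" "c \<in> \<O>" "d \<in> \<O>"
    using assms by (auto simp: GL2_O_def K D_def)
  have "inverse D \<in> \<O>" using D by (simp add: ring_unit_inverse)
  then have "d / D \<in> \<O>" "- b / D \<in> \<O>" "- c / D \<in> \<O>" "a / D \<in> \<O>"
    using abcd by (auto simp only: divide_inverse intro: ring_mult ring_minus)
  moreover have "(d / D) * (a / D) - (- b / D) * (- c / D) = D / (D * D)"
    by (simp add: D_def diff_divide_distrib mult.commute)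
  then have "(d / D) * (a / D) - (- b / D) * (- c / D) = inverse D"
    using D by (simp add: divide_simps)
  moreover have "d * a \<noteq> b * c"
    using D(1) unfolding D_def by (simp add: mult.commute)
  ultimately show ?thesis
    using D unfolding K minv.simps D_def [symmetric] GL2_O_def by (simp add: v_inverse)
qed

text \<open>\<open>K\<close> and its inverse both map O^2 into itself, so \<open>K\<close> preserves
  O^2 as a lattice and not only up to homothety.\<close>

lemma GL2_O_fixes_base:
  assumes "K \<in> GL2_O" shows "vact K \<xi> = \<xi>"
proof -
  have "mat_act K ` mat_act (minv K) ` (\<O> \<times> \<O>) \<subseteq> mat_act K ` (\<O> \<times> \<O>)"
    by (intro image_mono GL2_O_image GL2_O_minv assms)
  then have "\<O> \<times> \<O> \<subseteq> mat_act K ` (\<O> \<times> \<O>)"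
    by (simp add: image_image mat_act_minv_right [OF GL2_O_invertible [OF assms]])
  then have "mat_act K ` (\<O> \<times> \<O>) = \<O> \<times> \<O>"
    by (rule subset_antisym [OF GL2_O_image [OF assms]])
  then show ?thesis by (simp add: base_vertex_def vact_hclass)
qed

text \<open>Integral invertible matrices and scalars both fix the base vertex. The factorization is
  a premise so that each computation on standard vertices reduces to one matrix identity.\<close>

lemma vact_GL2_O_scalar_base:
  assumes "K \<in> GL2_O" and "c \<noteq> 0" and "B = mmul A (mmul K (c, 0, 0, c))"
  shows "vact B \<xi> = vact A \<xi>"
  using hclass_scalar_mat [OF \<open>c \<noteq> 0\<close>] GL2_O_fixes_base [OF \<open>K \<in> GL2_O\<close>]
  by (simp add: assms(3) vact_mmul) (simp add: base_vertex_def)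

section \<open>The standard apartment and matrices acting on it\<close>

abbreviation D :: "int \<Rightarrow> 'a mat2" where "D n \<equiv> (1, 0, 0, w powi n)"

abbreviation U :: "'a \<Rightarrow> 'a mat2" where "U b \<equiv> (1, 0, b, 1)"

text \<open>The whole apartment is indexed by integers: backward neighbours and shifts by triangular
  matrices may have a negative index.\<close>

definition std :: "int \<Rightarrow> ('a \<times> 'a) set set" where "std n = vact (D n) \<xi>"

lemma U_add: "vact (U (b + c)) X = vact (U b) (vact (U c) X)"
  by (simp flip: vact_mmul)

lemma std_0: "std 0 = \<xi>"
  by (simp add: std_def)

lemma D_std: "vact (D m) (std n) = std (m + n)"
  by (simp add: std_def power_int_add flip: vact_mmul)

text \<open>Conjugating \<open>U b\<close> by \<open>D n\<close> divides \<open>b\<close> by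
  \<open>w powi n\<close>, which leaves an integral matrix. So \<open>U b\<close> fixes the standard
  ray up to index \<open>v b\<close>.\<close>

lemma U_std:
  assumes "b = 0 \<or> n \<le> v b" shows "vact (U b) (std n) = std n"
proof -
  define c where "c = b * w powi (- n)"
  have "c \<in> \<O>" using assms by (cases "b = 0") (auto simp: val_ring_def c_def v_mult v_powi)
  then have "U c \<in> GL2_O" by (simp add: GL2_O_def)
  moreover have "mmul (U b) (D n) = mmul (D n) (mmul (U c) (1, 0, 0, 1))"
    by (simp add: c_def power_int_minus)
  ultimately show ?thesis
    unfolding std_def vact_mmul [symmetric] by (intro vact_GL2_O_scalar_base) auto
qed

text \<open>Exchanging the basis vectors reflects the apartment in the base vertex. This reorients a
  ray whose first step goes to \<open>std (-1)\<close>.\<close>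

lemma swap_std: "vact (0, 1, 1, 0) (std n) = std (- n)"
proof -
  have "(0, 1, 1, 0) \<in> GL2_O" by (simp add: GL2_O_def v_minus)
  moreover have "mmul (0, 1, 1, 0) (D n)
      = mmul (D (- n)) (mmul (0, 1, 1, 0) (w powi n, 0, 0, w powi n))"
    if "w powi n \<noteq> 0" using that by (simp add: power_int_minus)
  ultimately show ?thesis
    unfolding std_def vact_mmul [symmetric]
    by (intro vact_GL2_O_scalar_base [where c = "w powi n"]) auto
qed

text \<open>Pulling \<open>D (n + v d - v a)\<close> out on the left and the scalar \<open>a\<close>
  on the right leaves a unipotent entry \<open>b * w powi n / a\<close> and a unit on the diagonal.
  The bound on \<open>n\<close> says that the former is integral.\<close>

lemma upper_triangular_std:
  assumes "a \<noteq> 0" "d \<noteq> 0" and b: "b = 0 \<or> v a - v b \<le> n"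
  shows "vact (a, b, 0, d) (std n) = std (n + v d - v a)"
proof -
  define u where "u = d * w powi (v a - v d) / a"
  define t where "t = b * w powi n / a"
  have "v u = 0" "u \<noteq> 0" using assms by (auto simp: u_def v_mult v_divide v_powi)
  moreover have "t \<in> \<O>"
    using assms by (cases "b = 0") (auto simp: t_def val_ring_def v_mult v_divide v_powi)
  ultimately have "(1, t, 0, u) \<in> GL2_O" by (auto simp: GL2_O_def val_ring_def)
  moreover have "w powi (n + v d - v a) * w powi (v a - v d) = w powi n"
    by (simp flip: power_int_add)
  then have "mmul (a, b, 0, d) (D n) = mmul (D (n + v d - v a)) (mmul (1, t, 0, u) (a, 0, 0, a))"
    using assms by (simp add: t_def u_def mult.commute mult.left_commute)
  ultimately show ?thesis
    unfolding std_def vact_mmul [symmetric]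
    by (intro vact_GL2_O_scalar_base [where c = a]) (auto simp: assms)
qed

section \<open>Neighbours of a vertex\<close>

text \<open>Such an \<open>L\<close> is a line in the residue plane, spanned by the second basis
  vector or by some \<open>(1, c)\<close>. The case split asks whether a vector of \<open>L\<close>
  has a unit as first coordinate.\<close>

lemma lattice_between:
  assumes sub: "scale w (\<O> \<times> \<O>) \<subset> L" "L \<subset> \<O> \<times> \<O>"
    and add: "\<And>p p'. p \<in> L \<Longrightarrow> p' \<in> L \<Longrightarrow> (fst p + fst p', snd p + snd p') \<in> L"
    and mult: "\<And>s p. s \<in> \<O> \<Longrightarrow> p \<in> L \<Longrightarrow> (s * fst p, s * snd p) \<in> L"
  shows "L = mat_act (w, 0, 0, 1) ` (\<O> \<times> \<O>) \<or> (\<exists>c\<in>\<O>. L = mat_act (1, 0, c, w) ` (\<O> \<times> \<O>))"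
proof -
  have wL: "(w * x, w * y) \<in> L" if "x \<in> \<O>" "y \<in> \<O>" for x y
    using sub(1) that unfolding scale_def by force
  show ?thesis
  proof (cases "\<exists>(x, y)\<in>L. x / w \<notin> \<O>")
    case True
    then obtain x y where xy: "(x, y) \<in> L" "x / w \<notin> \<O>" by blast
    have x: "x \<in> \<O>" "y \<in> \<O>" using xy sub by auto
    then have ix: "inverse x \<in> \<O>" and "x \<noteq> 0" using xy ring_inverse by auto
    define c where "c = inverse x * y"
    have c: "c \<in> \<O>" unfolding c_def by (rule ring_mult [OF ix x(2)])
    have "(1, c) \<in> L" using mult [OF ix xy(1)] \<open>x \<noteq> 0\<close> by (simp add: c_def)
    then have line: "(s, s * c) \<in> L" if "s \<in> \<O>" for s using mult [OF that] by fastforce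
    have "mat_act (1, 0, c, w) (s, t) \<in> L" if "s \<in> \<O>" "t \<in> \<O>" for s t
      using add [OF line [OF that(1)] wL [OF ring_0 that(2)]] by (simp add: mat_act_def mult.commute)
    then have "mat_act (1, 0, c, w) ` (\<O> \<times> \<O>) \<subseteq> L" by blast
    moreover have "L \<subseteq> mat_act (1, 0, c, w) ` (\<O> \<times> \<O>)"
    proof clarify
      fix s y' assume L: "(s, y') \<in> L"
      then have s: "s \<in> \<O>" "y' \<in> \<O>" using sub by auto
      \<comment> \<open>Subtracting a multiple of \<open>(1, c)\<close> leaves a vertical vector; it
        remains to divide \<open>z\<close> by \<open>w\<close>.\<close>
      define z where "z = y' - s * c"
      have z: "(0, z) \<in> L"
        using add [OF L line [OF ring_minus [OF s(1)]]] by (simp add: z_def)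
      have "z \<in> \<O>" unfolding z_def using s c by (intro ring_diff ring_mult)
      have "z / w \<in> \<O>"
      proof (rule ccontr)
        \<comment> \<open>If \<open>z\<close> were a unit, \<open>(0, 1)\<close> and
          \<open>(1, c)\<close> would both lie in \<open>L\<close> and span O^2, against the strict
          inclusion.\<close>
        assume nz: "z / w \<notin> \<O>"
        then have iz: "inverse z \<in> \<O>" and "z \<noteq> 0" using ring_inverse \<open>z \<in> \<O>\<close> by auto
        have "(0, 1) \<in> L" using mult [OF iz z] \<open>z \<noteq> 0\<close> by simp
        then have vert: "(0, t) \<in> L" if "t \<in> \<O>" for t using mult [OF that] by fastforce
        have "(p, q) \<in> L" if "p \<in> \<O>" "q \<in> \<O>" for p q
          using add [OF line [OF that(1)] vert [of "q - p * c"]] that c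
          by (simp add: ring_diff ring_mult)
        then show False using sub(2) by auto
      qed
      moreover have "(s, y') = mat_act (1, 0, c, w) (s, z / w)"
        by (simp add: mat_act_def z_def mult.commute)
      ultimately show "(s, y') \<in> mat_act (1, 0, c, w) ` (\<O> \<times> \<O>)" using s by blast
    qed
    ultimately show ?thesis using c by blast
  next
    case False
    then have div: "x / w \<in> \<O>" if "(x, y) \<in> L" for x y using that by auto
    \<comment> \<open>All first coordinates are divisible by \<open>w\<close>, so a vector outside
      \<open>w\<close> times O^2 must have a unit as second coordinate.\<close>
    obtain x y where xy: "(x, y) \<in> L" "(x, y) \<notin> scale w (\<O> \<times> \<O>)" using sub(1) by auto
    have y: "y \<in> \<O>" using xy sub by auto
    have "y / w \<notin> \<O>"
    proof
      assume "y / w \<in> \<O>"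
      then have "(x, y) \<in> scale w (\<O> \<times> \<O>)"
        using div [OF xy(1)] unfolding scale_def
        by (intro image_eqI [of _ _ "(x / w, y / w)"]) auto
      then show False using xy(2) by simp
    qed
    then have iy: "inverse y \<in> \<O>" and "y \<noteq> 0" using ring_inverse y by auto
    have horiz: "(w * s, 0) \<in> L" if "s \<in> \<O>" for s using wL [OF that ring_0] by simp
    have "(0, y) \<in> L"
      using add [OF xy(1) horiz [OF ring_minus [OF div [OF xy(1)]]]] by simp
    then have "(0, 1) \<in> L" using mult [OF iy] \<open>y \<noteq> 0\<close> by fastforce
    then have vert: "(0, t) \<in> L" if "t \<in> \<O>" for t using mult [OF that] by fastforce
    have "mat_act (w, 0, 0, 1) (s, t) \<in> L" if "s \<in> \<O>" "t \<in> \<O>" for s t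
      using add [OF horiz [OF that(1)] vert [OF that(2)]] by (simp add: mat_act_def)
    then have "mat_act (w, 0, 0, 1) ` (\<O> \<times> \<O>) \<subseteq> L" by blast
    moreover have "L \<subseteq> mat_act (w, 0, 0, 1) ` (\<O> \<times> \<O>)"
    proof clarify
      fix s t assume L: "(s, t) \<in> L"
      then have "(s / w, t) \<in> \<O> \<times> \<O>" using sub div by auto
      moreover have "(s, t) = mat_act (w, 0, 0, 1) (s / w, t)" by (simp add: mat_act_def)
      ultimately show "(s, t) \<in> mat_act (w, 0, 0, 1) ` (\<O> \<times> \<O>)" by blast
    qed
    ultimately show ?thesis by blast
  qed
qed

lemma base_neighbour:
  assumes "adj v w \<xi> Y"
  shows "Y = std (-1) \<or> (\<exists>c\<in>\<O>. Y = vact (U c) (std 1))"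
proof -
  obtain L L' where L: "L \<in> \<xi>" "L' \<in> Y" "scale w L \<subset> L'" "L' \<subset> L" and Y: "Y \<in> vertices v"
    using assms unfolding adj_def by blast
  obtain c where c: "c \<noteq> 0" "L = scale c (\<O> \<times> \<O>)"
    using L(1) unfolding base_vertex_def hclass_def by blast
  obtain M where M: "invertible2 M" "Y = hclass (mat_act M ` (\<O> \<times> \<O>))"
    using Y unfolding vertices_def lattice_iff by blast
  obtain d where d: "d \<noteq> 0" "L' = scale d (mat_act M ` (\<O> \<times> \<O>))"
    using L(2) M(2) unfolding hclass_def by blast
  \<comment> \<open>Rescaling makes the larger lattice O^2 itself; \<open>N\<close> is the basis
    matrix of the rescaled neighbour.\<close>
  define L0 where "L0 = scale (inverse c) L'"
  define N where "N = mmul (inverse c * d, 0, 0, inverse c * d) M"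
  have L0: "L0 = mat_act N ` (\<O> \<times> \<O>)"
    by (simp add: L0_def N_def d scale_eq_mat_act image_image mat_act_mmul)
      (simp add: mat_act_def algebra_simps)
  have Y_L0: "Y = hclass L0"
    using c d by (simp add: L0_def M(2) hclass_scale)
  have inv: "invertible2 (inverse c, 0, 0, inverse c)" using c by (simp add: invertible2_def)
  have strict: "scale (inverse c) P \<subset> scale (inverse c) Q" if "P \<subset> Q" for P Q
    using that unfolding scale_eq_mat_act mat_act_image_psubset_iff [OF inv] .
  have "scale (inverse c) (scale w L) = scale w (\<O> \<times> \<O>)" "scale (inverse c) L = \<O> \<times> \<O>"
    using c by (simp_all add: scale_scale field_simps)
  then have "scale w (\<O> \<times> \<O>) \<subset> L0" "L0 \<subset> \<O> \<times> \<O>"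
    using strict [OF L(3)] strict [OF L(4)] by (simp_all add: L0_def)
  moreover have "(fst p + fst p', snd p + snd p') \<in> L0" if "p \<in> L0" "p' \<in> L0" for p p'
  proof -
    obtain s t s' t' where st: "s \<in> \<O>" "t \<in> \<O>" "s' \<in> \<O>" "t' \<in> \<O>"
      "p = mat_act N (s, t)" "p' = mat_act N (s', t')"
      using \<open>p \<in> L0\<close> \<open>p' \<in> L0\<close> unfolding L0 by blast
    then have "(fst p + fst p', snd p + snd p') = mat_act N (s + s', t + t')"
      by (cases N) (simp add: mat_act_def algebra_simps)
    then show ?thesis using st unfolding L0 by (auto intro!: imageI ring_add)
  qed
  moreover have "(a * fst p, a * snd p) \<in> L0" if "a \<in> \<O>" "p \<in> L0" for a p
  proof -
    obtain s t where st: "s \<in> \<O>" "t \<in> \<O>" "p = mat_act N (s, t)"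
      using \<open>p \<in> L0\<close> unfolding L0 by blast
    then have "(a * fst p, a * snd p) = mat_act N (a * s, a * t)"
      by (cases N) (simp add: mat_act_def algebra_simps)
    then show ?thesis using st \<open>a \<in> \<O>\<close> unfolding L0 by (auto intro!: imageI ring_mult)
  qed
  ultimately have "L0 = mat_act (w, 0, 0, 1) ` (\<O> \<times> \<O>) \<or>
      (\<exists>b\<in>\<O>. L0 = mat_act (1, 0, b, w) ` (\<O> \<times> \<O>))"
    by (rule lattice_between)
  then consider "L0 = mat_act (w, 0, 0, 1) ` (\<O> \<times> \<O>)"
    | b where "b \<in> \<O>" "L0 = mat_act (1, 0, b, w) ` (\<O> \<times> \<O>)"
    by blast
  then show ?thesis
  proof cases
    case 1
    \<comment> \<open>The matrix \<open>(w, 0, 0, 1)\<close> is \<open>D (-1)\<close> times the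
      scalar \<open>w\<close>.\<close>
    have "vact (mmul (D (-1)) (w, 0, 0, w)) \<xi> = std (-1)"
      unfolding vact_mmul std_def
      using hclass_scalar_mat [OF w_nonzero] by (simp add: base_vertex_def)
    then show ?thesis using 1 by (simp add: Y_L0 base_vertex_def vact_hclass)
  next
    case (2 b)
    then have "Y = vact (mmul (U b) (D 1)) \<xi>" by (simp add: Y_L0 base_vertex_def vact_hclass)
    then have "Y = vact (U b) (std 1)" by (simp only: vact_mmul std_def)
    then show ?thesis using 2(1) by blast
  qed
qed

text \<open>Translating by \<open>mmul A (D n)\<close> reduces to the base vertex. Moving
  \<open>D n\<close> past \<open>U c\<close> multiplies \<open>c\<close> by \<open>w powi n\<close>,
  whence the bound on the valuation.\<close>

lemma std_neighbour:
  assumes A: "invertible2 A" and adj: "adj v w (vact A (std n)) Y"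
  shows "Y = vact A (std (n - 1)) \<or>
    (\<exists>c. (c = 0 \<or> n \<le> v c) \<and> Y = vact A (vact (U c) (std (n + 1))))"
proof -
  define P where "P = mmul A (D n)"
  have P: "invertible2 P" unfolding P_def by (rule invertible2_mmul [OF A]) (simp add: invertible2_def)
  define Y' where "Y' = vact (minv P) Y"
  have Y: "Y = vact P Y'" by (simp add: Y'_def vact_minv_right [OF P])
  have "vact A (std n) = vact P \<xi>" by (simp add: P_def vact_mmul std_def)
  then have "adj v w \<xi> Y'"
    using vact_adj [OF invertible2_minv [OF P] adj] by (simp add: vact_minv_left [OF P] Y'_def)
  then consider "Y' = std (-1)" | c where "c \<in> \<O>" "Y' = vact (U c) (std 1)"
    using base_neighbour by blast
  then show ?thesis
  proof cases
    case 1
    then show ?thesis by (simp add: Y P_def vact_mmul D_std)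
  next
    case (2 c)
    define b where "b = w powi n * c"
    have "b = 0 \<or> n \<le> v b"
      using 2(1) by (cases "c = 0") (auto simp: b_def val_ring_def v_mult v_powi)
    moreover have "mmul (D n) (U c) = mmul (U b) (D n)" by (simp add: b_def)
    then have "vact (D n) (vact (U c) (std 1)) = vact (U b) (std (n + 1))"
      by (metis vact_mmul D_std)
    ultimately show ?thesis using 2 by (auto simp: Y P_def vact_mmul)
  qed
qed

section \<open>Coordinates for rays\<close>

lemma ray_eq_std:
  assumes "ray v w r"
  shows "\<exists>A. invertible2 A \<and> (\<forall>n. r n = vact A (std (int n)))"
proof -
  have inj: "inj r" and adj: "\<And>n. adj v w (r n) (r (Suc n))"
    using assms by (auto simp: ray_def)
  have "r 0 \<in> vertices v" using adj [of 0] by (simp add: adj_def)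
  then obtain A0 where A0: "invertible2 A0" "r 0 = vact A0 (std 0)"
    unfolding vertices_eq std_0 by blast
  \<comment> \<open>If the first step is backward, the swap turns it into a forward one with
    \<open>c0 = 0\<close>.\<close>
  obtain A c0 where A: "invertible2 A" "r 0 = vact A (std 0)"
    and c0: "c0 = 0 \<or> 0 \<le> v c0" "r 1 = vact A (vact (U c0) (std 1))"
  proof -
    have swap: "invertible2 (mmul A0 (0, 1, 1, 0))"
      by (rule invertible2_mmul [OF A0(1)]) (simp add: invertible2_def)
    show thesis
      using std_neighbour [OF A0(1), of 0 "r 1"] adj [of 0] A0
        that [of A0] that [OF swap, of 0]
      by (auto simp: vact_mmul swap_std)
  qed
  \<comment> \<open>Stage \<open>n\<close> already covers index \<open>n + 1\<close>, since
    \<open>c0\<close> settles the first step. Later corrections then have valuation at least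
    \<open>n + 1\<close>; the recorded bound \<open>n\<close> suffices for convergence.\<close>
  define P where "P n b \<longleftrightarrow> (\<forall>i\<le>Suc n. r i = vact A (vact (U b) (std (int i))))" for n b
  have "\<exists>b. \<forall>n. P n (b n) \<and> (b (Suc n) - b n = 0 \<or> int n \<le> v (b (Suc n) - b n))"
  proof (rule dependent_nat_choice)
    have "vact (U c0) (std 0) = std 0" using c0(1) by (rule U_std)
    then have "P 0 c0" using A c0 by (auto simp: P_def le_Suc_eq)
    then show "\<exists>b. P 0 b" by blast
  next
    fix b n assume b: "P n b"
    have AU: "invertible2 (mmul A (U b))"
      by (rule invertible2_mmul [OF A(1)]) (simp add: invertible2_def)
    have r: "r i = vact (mmul A (U b)) (std (int i))" if "i \<le> Suc n" for i
      using b that by (simp add: P_def vact_mmul)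
    \<comment> \<open>Injectivity of the ray rules out backtracking to \<open>r n\<close>, which
      leaves the forward neighbours.\<close>
    have "r (Suc (Suc n)) \<noteq> vact (mmul A (U b)) (std (int (Suc n) - 1))"
      using injD [OF inj, of "Suc (Suc n)" n] r [of n] by auto
    then obtain c where c: "c = 0 \<or> int (Suc n) \<le> v c"
      "r (Suc (Suc n)) = vact (mmul A (U b)) (vact (U c) (std (int (Suc n) + 1)))"
      using std_neighbour [OF AU, of "int (Suc n)" "r (Suc (Suc n))"] adj [of "Suc n"] r [of "Suc n"]
      by auto
    \<comment> \<open>\<open>U c\<close> fixes the standard vertices up to index
      \<open>n + 1\<close>, so the correction does not disturb the vertices already matched.\<close>
    have "r i = vact A (vact (U (b + c)) (std (int i)))" if "i \<le> Suc (Suc n)" for i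
    proof (cases "i = Suc (Suc n)")
      case True
      then show ?thesis using c(2) by (simp only: U_add vact_mmul) (simp add: ac_simps)
    next
      case False
      then have "i \<le> Suc n" using that by simp
      then have "vact (U c) (std (int i)) = std (int i)" using c(1) by (intro U_std) auto
      then show ?thesis using r [OF \<open>i \<le> Suc n\<close>] by (simp only: U_add vact_mmul)
    qed
    then have "P (Suc n) (b + c)" by (simp add: P_def)
    then show "\<exists>b'. P (Suc n) b' \<and> (b' - b = 0 \<or> int n \<le> v (b' - b))"
      using c(1) by (intro exI [of _ "b + c"]) auto
  qed
  then obtain b where b: "\<And>n. P n (b n)"
    and step: "\<And>n. b (Suc n) - b n = 0 \<or> int n \<le> v (b (Suc n) - b n)" by blast
  \<comment> \<open>Telescoping with the ultrametric inequality: all later differences keep the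
    bound of the first one.\<close>
  have incr: "b (m + k) - b m = 0 \<or> int m \<le> v (b (m + k) - b m)" for m k
  proof (induction k)
    case (Suc k)
    have "b (m + Suc k) - b m = (b (Suc (m + k)) - b (m + k)) + (b (m + k) - b m)" by simp
    then show ?case
      using Suc step [of "m + k"] v_add [of "b (Suc (m + k)) - b (m + k)" "b (m + k) - b m"]
      by (smt (verit) add_0 add.right_neutral of_nat_add of_nat_0_le_iff)
  qed simp
  have "\<exists>M. \<forall>m\<ge>M. \<forall>n\<ge>M. b m = b n \<or> N \<le> v (b m - b n)" for N
  proof (intro exI [of _ "nat N"] allI impI)
    fix m n assume "nat N \<le> m" "nat N \<le> n"
    then show "b m = b n \<or> N \<le> v (b m - b n)"
    proof (induction m n rule: linorder_wlog)
      case (le m n)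
      then show ?case
        using incr [of m "n - m"] v_minus [of "b n - b m"] by (cases "b n = b m") auto
    next
      case (sym m n)
      then show ?case using v_minus [of "b m - b n"] by (cases "b m = b n") auto
    qed
  qed
  then obtain l where l: "\<And>N. \<exists>M. \<forall>n\<ge>M. b n = l \<or> N \<le> v (b n - l)"
    using local_field unfolding nonarch_local_field_def by blast
  have "r i = vact (mmul A (U l)) (std (int i))" for i
  proof -
    obtain M where M: "\<forall>n\<ge>M. b n = l \<or> int i \<le> v (b n - l)" using l by blast
    \<comment> \<open>Stage \<open>n\<close> must cover index \<open>i\<close> and also be so close
      to the limit \<open>l\<close> that \<open>U (b n - l)\<close> fixes
      \<open>std i\<close>.\<close>
    define n where "n = max M i"
    have "b n - l = 0 \<or> int i \<le> v (b n - l)" using M by (auto simp: n_def)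
    then have "vact (U (b n - l)) (std (int i)) = std (int i)" by (rule U_std)
    moreover have "r i = vact A (vact (U (l + (b n - l))) (std (int i)))"
      using b [of n] by (simp add: P_def n_def)
    ultimately show ?thesis by (simp only: U_add vact_mmul)
  qed
  moreover have "invertible2 (mmul A (U l))"
    by (rule invertible2_mmul [OF A(1)]) (simp add: invertible2_def)
  ultimately show ?thesis by blast
qed

section \<open>Iwasawa decomposition and transitivity on ends\<close>

text \<open>Row reduction of the first column \<open>(p, q)\<close>: taking the entry of smaller
  valuation as pivot keeps the multiplier integral. If the pivot is \<open>q\<close>, a row exchange
  is built into \<open>K\<close>.\<close>

lemma iwasawa:
  assumes "invertible2 N"
  shows "\<exists>K a b d. K \<in> GL2_O \<and> a \<noteq> 0 \<and> d \<noteq> 0 \<and> N = mmul K (a, b, 0, d)"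
proof -
  obtain p r q s where N: "N = (p, r, q, s)" by (cases N)
  have det: "p * s - r * q \<noteq> 0" using assms by (simp add: N invertible2_def)
  show ?thesis
  proof (cases "p \<noteq> 0 \<and> (q = 0 \<or> v p \<le> v q)")
    case True
    then have "q / p \<in> \<O>" by (cases "q = 0") (auto simp: val_ring_def v_divide)
    then have "(1, 0, q / p, 1) \<in> GL2_O" by (simp add: GL2_O_def)
    moreover have "s - q * r / p \<noteq> 0" using True det by (auto simp: field_simps)
    moreover have "N = mmul (1, 0, q / p, 1) (p, r, 0, s - q * r / p)" using True by (simp add: N)
    ultimately show ?thesis using True by blast
  next
    case False
    then have "q \<noteq> 0" using det by auto
    then have "p / q \<in> \<O>" using False by (cases "p = 0") (auto simp: val_ring_def v_divide)
    then have "(p / q, 1, 1, 0) \<in> GL2_O" by (simp add: GL2_O_def v_minus)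
    moreover have "r - p * s / q \<noteq> 0" using \<open>q \<noteq> 0\<close> det by (auto simp: field_simps)
    moreover have "N = mmul (p / q, 1, 1, 0) (q, s, 0, r - p * s / q)" using \<open>q \<noteq> 0\<close> by (simp add: N)
    ultimately show ?thesis using \<open>q \<noteq> 0\<close> by blast
  qed
qed

lemma stabilizer_transitive_on_ends:
  assumes "ray v w x" "ray v w y"
  shows "\<exists>M. invertible2 M \<and> vact M (x 0) = x 0 \<and> same_end y (vact M \<circ> x)"
proof -
  obtain A where A: "invertible2 A" "\<And>n. x n = vact A (std (int n))"
    using ray_eq_std [OF assms(1)] by blast
  obtain A' where A': "invertible2 A'" "\<And>n. y n = vact A' (std (int n))"
    using ray_eq_std [OF assms(2)] by blast
  obtain K a b d where K: "K \<in> GL2_O" and T: "a \<noteq> 0" "d \<noteq> 0"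
    and KT: "mmul (minv A) A' = mmul K (a, b, 0, d)"
    using iwasawa [OF invertible2_mmul [OF invertible2_minv [OF A(1)] A'(1)]] by blast
  define M where "M = mmul (mmul A K) (minv A)"
  have "invertible2 M"
    unfolding M_def by (intro invertible2_mmul invertible2_minv A GL2_O_invertible K)
  moreover have Mx: "vact M (x n) = vact A (vact K (std (int n)))" for n
    by (simp add: M_def A(2) vact_mmul vact_minv_left [OF A(1)])
  have "vact M (x 0) = x 0"
    unfolding Mx by (simp add: A(2) std_0 GL2_O_fixes_base [OF K])
  moreover have "A' = mmul A (mmul K (a, b, 0, d))"
    by (simp flip: KT mmul_assoc add: minv_right [OF A(1)])
  then have y: "y n = vact A (vact K (vact (a, b, 0, d) (std (int n))))" for n
    by (simp add: A'(2) vact_mmul)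
  \<comment> \<open>The first bound lets the triangular matrix act as a shift from index
    \<open>i\<close> on; the second makes the shifted index nonnegative. If \<open>b = 0\<close>,
    the unspecified \<open>v b\<close> only affects the size of \<open>i\<close>.\<close>
  define i where "i = nat (max (v a - v b) (v a - v d))"
  define j where "j = nat (int i + v d - v a)"
  have ij: "int (n + i) + v d - v a = int (n + j)" "v a - v b \<le> int (n + i)" for n
    by (auto simp: i_def j_def)
  have "vact (a, b, 0, d) (std (int (n + i))) = std (int (n + j))" for n
    using upper_triangular_std [OF T, of b "int (n + i)"] ij(2) [of n] unfolding ij(1) by blast
  then have "y (n + i) = (vact M \<circ> x) (n + j)" for n
    by (simp only: y Mx comp_apply)
  then have "same_end y (vact M \<circ> x)" unfolding same_end_def by blast
  ultimately show ?thesis by blast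
qed

end

theorem mainTheorem9:
  fixes v :: "'a::field \<Rightarrow> int" and w :: 'a and e :: nat
    and xs :: "int \<Rightarrow> ('a \<times> 'a) set set"
    and g :: "('a \<times> 'a) set set \<Rightarrow> ('a \<times> 'a) set set"
  assumes "nonarch_local_field v"
    and "w \<noteq> 0" and "v w = 1"
    and "e \<ge> 1"
    and "biinf_path v w xs"
    and "g \<in> Ghat v w e"
  shows "\<exists>k b. k \<in> Ghat v w e \<and> k (xs 0) = xs 0 \<and>
             b \<in> Ghat v w e \<and> same_end (b \<circ> (\<lambda>n. xs (int n))) (\<lambda>n. xs (int n)) \<and>
             (\<forall>y\<in>vertices v. g y = k (b y))"
proof -
  interpret valued_field v w by unfold_locales fact+
  define x where "x n = xs (int n)" for n
  have x: "ray v w x"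
    using assms(5) unfolding ray_def biinf_path_def x_def inj_def
    by (metis of_nat_Suc of_nat_eq_iff add.commute)
  have x_vert: "x n \<in> vertices v" for n using x by (auto simp: ray_def adj_def)
  have "inj_on g (vertices v)"
    using assms(6) by (auto simp: Ghat_def tree_aut_def bij_betw_def)
  then have "inj (g \<circ> x)" using x x_vert unfolding ray_def inj_def inj_on_def by auto
  \<comment> \<open>The image ray may start at any vertex: only its end is compared with that of
    \<open>vact M \<circ> x\<close>.\<close>
  then have "ray v w (g \<circ> x)" using x Ghat_adj [OF assms(6)] by (auto simp: ray_def)
  then obtain M where M: "invertible2 M" "vact M (x 0) = x 0" "same_end (g \<circ> x) (vact M \<circ> x)"
    using stabilizer_transitive_on_ends [OF x] by blast
  define b where "b = vact (minv M) \<circ> g"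
  have "b \<in> Ghat v w e"
    unfolding b_def by (rule vact_comp_in_Ghat [OF invertible2_minv [OF M(1)] assms(6)])
  \<comment> \<open>Cancelling \<open>M\<close> on a common tail of \<open>g \<circ> x\<close> and
    \<open>vact M \<circ> x\<close> shows that \<open>b\<close> fixes the end of
    \<open>x\<close>.\<close>
  moreover have "same_end (b \<circ> x) x"
    using M(3) unfolding same_end_def b_def comp_apply by (metis vact_minv_left [OF M(1)])
  moreover have "g y = vact M (b y)" for y by (simp add: b_def vact_minv_right [OF M(1)])
  ultimately show ?thesis
    using M(2) vact_in_Ghat [OF M(1), of v w e] unfolding x_def
    by (intro exI [of _ "vact M"] exI [of _ b]) simp
qed

end
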